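(* Let $\mathbb{K}$ be a field of characteristic $0$. Given a short exact sequence of Abelian groups $$0\longrightarrow K\xrightarrow{\ \varphi\ }G\xrightarrow{\ \pi\ }H\longrightarrow0,$$ a $G$-graded algebra $\mathcal{A}$ over $\mathbb{K}$ is strongly $G$-graded if and only if both the induced $H$-grading on $\mathcal{A}$ and the induced $K$-grading on $\mathcal{A}^{(K)}$ are strong.
   Context: All algebras are associative and unital over $\mathbb{K}$. For a group $G$, a $G$-graded algebra $\mathcal{A}$ decomposes into a direct sum of subspaces $\mathcal{A}=\bigoplus_{g\in G}\mathcal{A}_g$ with $\mathcal{A}_g\mathcal{A}_h\subseteq\mathcal{A}_{gh}$ for all $g,h\in G$; it is strongly $G$-graded (the grading is strong) if $\mathcal{A}_g\mathcal{A}_h=\mathcal{A}_{gh}$ for all $g,h\in G$. (Abelian groups are written additively, so $gh$ is then $g+h$.) Let $\mathcal{A}$ be $G$-graded. The group epimorphism $\pi:G\to H$ induces an $H$-grading on $\mathcal{A}$ with components $\mathcal{A}_h=\bigoplus_{g\in\pi^{-1}(h)}\mathcal{A}_g$, $h\in H$. The group monomorphism $\varphi:K\to G$ defines the $K$-graded algebra $\mathcal{A}^{(K)}=\bigoplus_{k\in K}\mathcal{A}_{\varphi(k)}$, whose degree-$k$ component is $\mathcal{A}_{\varphi(k)}$. *)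

theory Defs
  imports "HOL-Algebra.Algebra"
begin

text \<open>
  The library locale \<open>algebra\<close> is restricted to commutative algebras, hence the following.
  The zero algebra is allowed.
\<close>

locale assoc_unital_algebra = module F A + field F + A: ring A for F (structure) and A (structure) +
  assumes smult_mult_left:
      "\<lbrakk>a \<in> carrier F; x \<in> carrier A; y \<in> carrier A\<rbrakk> \<Longrightarrow>
         (a \<odot>\<^bsub>A\<^esub> x) \<otimes>\<^bsub>A\<^esub> y = a \<odot>\<^bsub>A\<^esub> (x \<otimes>\<^bsub>A\<^esub> y)"
    and smult_mult_right:
      "\<lbrakk>a \<in> carrier F; x \<in> carrier A; y \<in> carrier A\<rbrakk> \<Longrightarrow>
         x \<otimes>\<^bsub>A\<^esub> (a \<odot>\<^bsub>A\<^esub> y) = a \<odot>\<^bsub>A\<^esub> (x \<otimes>\<^bsub>A\<^esub> y)"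

definition sum_of_family ::
    "('a, 'm) ring_scheme \<Rightarrow> 'i set \<Rightarrow> ('i \<Rightarrow> 'a set) \<Rightarrow> 'a set" where
  "sum_of_family A I C =
     {finsum A f J | f J. finite J \<and> J \<subseteq> I \<and> (\<forall>i\<in>J. f i \<in> C i)}"

definition independent_family ::
    "('a, 'm) ring_scheme \<Rightarrow> 'i set \<Rightarrow> ('i \<Rightarrow> 'a set) \<Rightarrow> bool" where
  "independent_family A I C \<longleftrightarrow>
     (\<forall>J f. finite J \<and> J \<subseteq> I \<and> (\<forall>i\<in>J. f i \<in> C i) \<and> finsum A f J = \<zero>\<^bsub>A\<^esub>
        \<longrightarrow> (\<forall>i\<in>J. f i = \<zero>\<^bsub>A\<^esub>))"

text \<open>
  The grading group is written multiplicatively. For subspaces \<open>V\<close> and \<open>W\<close>, the library's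
  \<open>ideal_prod A V W\<close> is the set of all finite sums of products \<open>v w\<close>; being closed under
  scalars, it is the linear span of these products. Neither \<open>V\<close> nor \<open>W\<close> has to be an ideal.
\<close>

locale graded_algebra = assoc_unital_algebra F A + G: group G
  for F (structure) and A (structure) and G (structure) and C +
  assumes component_subspace: "g \<in> carrier G \<Longrightarrow> submodule (C g) F A"
    and components_span: "carrier A = sum_of_family A (carrier G) C"
    and components_independent: "independent_family A (carrier G) C"
    and component_mult:
      "\<lbrakk>g \<in> carrier G; h \<in> carrier G\<rbrakk> \<Longrightarrow> ideal_prod A (C g) (C h) \<subseteq> C (g \<otimes>\<^bsub>G\<^esub> h)"

locale strongly_graded_algebra = graded_algebra F A G C
  for F (structure) and A (structure) and G (structure) and C +
  assumes component_mult_eq: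
      "\<lbrakk>g \<in> carrier G; h \<in> carrier G\<rbrakk> \<Longrightarrow> ideal_prod A (C g) (C h) = C (g \<otimes>\<^bsub>G\<^esub> h)"

definition quotient_grading ::
    "('a, 'm) ring_scheme \<Rightarrow> ('g, 'n) monoid_scheme \<Rightarrow> ('g \<Rightarrow> 'h) \<Rightarrow> ('g \<Rightarrow> 'a set) \<Rightarrow> 'h \<Rightarrow> 'a set"
  where "quotient_grading A G \<pi> C h = sum_of_family A {g \<in> carrier G. \<pi> g = h} C"

text \<open>
  The algebra structure on the sum of the components \<open>C (\<phi> k)\<close> is the restriction of
  that of \<open>A\<close>; in particular it has the same unit.
\<close>

definition restricted_algebra ::
    "('f, 'a, 'm) module_scheme \<Rightarrow> ('k, 'n) monoid_scheme \<Rightarrow> ('k \<Rightarrow> 'g) \<Rightarrow> ('g \<Rightarrow> 'a set)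
       \<Rightarrow> ('f, 'a, 'm) module_scheme"
  where "restricted_algebra A K \<phi> C =
     A\<lparr>carrier := sum_of_family A (carrier K) (\<lambda>k. C (\<phi> k))\<rparr>"

definition restricted_grading :: "('k \<Rightarrow> 'g) \<Rightarrow> ('g \<Rightarrow> 'a set) \<Rightarrow> 'k \<Rightarrow> 'a set"
  where "restricted_grading \<phi> C k = C (\<phi> k)"

text \<open>
  The library's \<open>short_exact_sequence\<close> forces all groups to have the same element type;
  this is its characterisation \<open>short_exact_sequence_iff\<close> with the types left independent.
\<close>

definition short_exact_abelian ::
    "('k, 'm) monoid_scheme \<Rightarrow> ('k \<Rightarrow> 'g) \<Rightarrow> ('g, 'n) monoid_scheme \<Rightarrow> ('g \<Rightarrow> 'h)
       \<Rightarrow> ('h, 'p) monoid_scheme \<Rightarrow> bool"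
  where "short_exact_abelian K \<phi> G \<pi> H \<longleftrightarrow>
     comm_group K \<and> comm_group G \<and> comm_group H \<and>
     \<phi> \<in> mon K G \<and> \<pi> \<in> epi G H \<and> \<phi> ` carrier K = kernel G H \<pi>"

end

theory Submission
  imports Defs
begin

text \<open>
  Strength of a grading by a group is a statement about the unit. Write \<open>A(g)\<close> for the component of
  degree \<open>g\<close>, and \<open>g'\<close> for the inverse of \<open>g\<close>. Then \<open>A\<close> is strongly graded as soon as
  \<open>1 \<in> A(g) A(g')\<close> for every \<open>g\<close>, because
  \<open>A(g h) = 1 A(g h) \<subseteq> A(g) (A(g') A(g h)) \<subseteq> A(g) A(h)\<close> (\<open>strongly_gradedI\<close>).

  If the \<open>G\<close>-grading is strong, so is the \<open>K\<close>-grading, whose components are components of \<open>A\<close>. So is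
  the \<open>H\<close>-grading: \<open>\<pi>\<close> being onto, any \<open>g\<close> over \<open>h\<^sub>1 h\<^sub>2\<close> factors as \<open>a b\<close> with \<open>a\<close> over \<open>h\<^sub>1\<close> and \<open>b\<close> over
  \<open>h\<^sub>2\<close>, and \<open>A(g) = A(a) A(b)\<close>.

  Conversely, let both induced gradings be strong and fix \<open>g\<close>. Strength over \<open>H\<close> writes \<open>1\<close> as a sum
  of products of homogeneous elements \<open>x \<in> A(p)\<close> and \<open>y \<in> A(q)\<close> with \<open>\<pi> p = \<pi> g\<close> and
  \<open>\<pi> q = \<pi> g'\<close>. As \<open>1\<close> has degree \<open>1\<close> (\<open>one_in_component_one\<close>), the products with \<open>p q \<noteq> 1\<close> cancel.
  In the others \<open>q = p'\<close>, and exactness gives \<open>p = g u\<close> with \<open>u\<close> in the image of \<open>K\<close>. Strength over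
  \<open>K\<close> gives \<open>1 \<in> A(u') A(u)\<close>, and inserting this unit between the factors yields
  \<open>x y = x 1 y \<in> (A(g u) A(u')) (A(u) A(u' g')) \<subseteq> A(g) A(g')\<close> (\<open>insert_unit\<close>). Hence
  \<open>1 \<in> A(g) A(g')\<close>.
\<close>

section \<open>Sums of families of additive subgroups\<close>

context abelian_group
begin

lemma subgroup_addD:
  assumes "subgroup S (add_monoid G)"
  shows "S \<subseteq> carrier G" "\<zero> \<in> S" "\<And>x y. \<lbrakk>x \<in> S; y \<in> S\<rbrakk> \<Longrightarrow> x \<oplus> y \<in> S" "\<And>x. x \<in> S \<Longrightarrow> \<ominus> x \<in> S"
  using subgroup.subset[OF assms] subgroup.one_closed[OF assms] subgroup.m_closed[OF assms]
    subgroup.m_inv_closed[OF assms, folded a_inv_def] by simp_all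

lemma finsum_in_subgroup:
  assumes S: "subgroup S (add_monoid G)" and "finite J" "\<And>i. i \<in> J \<Longrightarrow> f i \<in> S"
  shows "finsum G f J \<in> S"
  using assms(2,3)
proof (induction J)
  case empty
  then show ?case using subgroup_addD[OF S] by simp
next
  case (insert x J)
  then have "f \<in> J \<rightarrow> carrier G" "f x \<in> carrier G" using subgroup_addD(1)[OF S] by auto
  with insert show ?case using subgroup_addD[OF S] by simp
qed

lemma sum_of_family_least:
  assumes "subgroup S (add_monoid G)" "\<And>i. i \<in> I \<Longrightarrow> C i \<subseteq> S"
  shows "sum_of_family G I C \<subseteq> S"
  using assms unfolding sum_of_family_def by (auto intro!: finsum_in_subgroup)

lemma sum_of_family_member:
  assumes "i \<in> I" "x \<in> C i" "C i \<subseteq> carrier G"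
  shows "x \<in> sum_of_family G I C"
proof -
  have "finsum G (\<lambda>_. x) {i} = x" using assms by (simp add: subset_iff)
  then show ?thesis unfolding sum_of_family_def using assms
    by (intro CollectI exI[of _ "\<lambda>_. x"] exI[of _ "{i}"]) auto
qed

lemma sum_of_family_induct [consumes 1, case_names carrier zero add component]:
  assumes x: "x \<in> sum_of_family G I C" and carr: "\<And>i. i \<in> I \<Longrightarrow> C i \<subseteq> carrier G"
    and "P \<zero>" and add: "\<And>x y. \<lbrakk>x \<in> carrier G; y \<in> carrier G; P x; P y\<rbrakk> \<Longrightarrow> P (x \<oplus> y)"
    and comp: "\<And>i x. \<lbrakk>i \<in> I; x \<in> C i\<rbrakk> \<Longrightarrow> P x"
  shows "P x"
proof -
  obtain f J where "finite J" "J \<subseteq> I" "\<And>i. i \<in> J \<Longrightarrow> f i \<in> C i" and x: "x = finsum G f J"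
    using x unfolding sum_of_family_def by blast
  then have "P (finsum G f J)"
  proof (induction J arbitrary: x)
    case empty
    then show ?case using \<open>P \<zero>\<close> by simp
  next
    case (insert i J)
    then have "f \<in> J \<rightarrow> carrier G" "f i \<in> carrier G" using carr by blast+
    with insert show ?case using comp[of i "f i"] by (auto intro!: add)
  qed
  with x show ?thesis by simp
qed

lemma sum_of_family_subgroup:
  assumes C: "\<And>i. i \<in> I \<Longrightarrow> subgroup (C i) (add_monoid G)"
  shows "subgroup (sum_of_family G I C) (add_monoid G)"
proof -
  let ?S = "sum_of_family G I C"
  note CD = subgroup_addD[OF C]
  have zero: "\<zero> \<in> ?S"
    unfolding sum_of_family_def by (intro CollectI exI[of _ "\<lambda>_. \<zero>"] exI[of _ "{}"]) auto
  have add: "x \<oplus> y \<in> ?S" if "x \<in> ?S" "y \<in> ?S" for x y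
  proof -
    obtain f J where f: "finite J" "J \<subseteq> I" "\<And>i. i \<in> J \<Longrightarrow> f i \<in> C i" "x = finsum G f J"
      using \<open>x \<in> ?S\<close> unfolding sum_of_family_def by blast
    obtain g L where g: "finite L" "L \<subseteq> I" "\<And>i. i \<in> L \<Longrightarrow> g i \<in> C i" "y = finsum G g L"
      using \<open>y \<in> ?S\<close> unfolding sum_of_family_def by blast
    \<comment> \<open>Padding both families with zeros gives them the common index set \<open>J \<union> L\<close>.\<close>
    define f' where "f' i = (if i \<in> J then f i else \<zero>)" for i
    define g' where "g' i = (if i \<in> L then g i else \<zero>)" for i
    have f': "f' i \<in> C i" and g': "g' i \<in> C i" if "i \<in> J \<union> L" for i
      using that f g CD(2) unfolding f'_def g'_def by auto
    then have car: "f' \<in> J \<union> L \<rightarrow> carrier G" "g' \<in> J \<union> L \<rightarrow> carrier G"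
      using f(2) g(2) CD(1) by blast+
    have "x = finsum G f' (J \<union> L)" unfolding f(4)
      by (rule add.finprod_mono_neutral_cong_left) (use f g car in \<open>auto simp: f'_def\<close>)
    moreover have "y = finsum G g' (J \<union> L)" unfolding g(4)
      by (rule add.finprod_mono_neutral_cong_left) (use f g car in \<open>auto simp: g'_def\<close>)
    ultimately have "x \<oplus> y = finsum G (\<lambda>i. f' i \<oplus> g' i) (J \<union> L)"
      using finsum_addf[OF car] by simp
    moreover have "f' i \<oplus> g' i \<in> C i" if "i \<in> J \<union> L" for i
      using that CD(3) f' g' f(2) g(2) by blast
    ultimately show ?thesis using f(1,2) g(1,2) unfolding sum_of_family_def
      by (intro CollectI exI[of _ "\<lambda>i. f' i \<oplus> g' i"] exI[of _ "J \<union> L"]) auto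
  qed
  have carr: "?S \<subseteq> carrier G"
    by (rule sum_of_family_least) (use CD add.group_incl_imp_subgroup add.subgroup_self in auto)
  have minus: "\<ominus> x \<in> ?S" if "x \<in> ?S" for x
    using that
  proof (induction rule: sum_of_family_induct)
    case (component i x)
    then show ?case using CD by (intro sum_of_family_member[of i]) auto
  qed (use CD zero add in \<open>auto simp: minus_add minus_equality[of \<zero> \<zero>]\<close>)
  show ?thesis
    using carr zero add minus by (intro add.subgroupI) auto
qed

text \<open>A vanishing sum of block elements expands, the blocks being disjoint, into a vanishing sum of
  members of the original family, one for each index. So all these members are zero, and with them
  the block elements.\<close>

lemma independent_family_blocks:
  assumes ind: "independent_family G I C" and carr: "\<And>i. i \<in> I \<Longrightarrow> C i \<subseteq> carrier G"
  shows "independent_family G P (\<lambda>h. sum_of_family G {i \<in> I. p i = h} C)"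
  unfolding independent_family_def
proof (intro allI impI ballI; elim conjE)
  fix J f h
  assume J: "finite J" "J \<subseteq> P" and f: "\<forall>h\<in>J. f h \<in> sum_of_family G {i \<in> I. p i = h} C"
    and sum0: "finsum G f J = \<zero>" and "h \<in> J"
  have "\<exists>c L. finite L \<and> L \<subseteq> {i \<in> I. p i = h} \<and> (\<forall>i\<in>L. c i \<in> C i) \<and> f h = finsum G c L"
    if "h \<in> J" for h
  proof -
    from f that have "f h \<in> sum_of_family G {i \<in> I. p i = h} C" by (rule bspec)
    then show ?thesis unfolding sum_of_family_def by (elim CollectE exE conjE) (intro exI conjI)
  qed
  then obtain d L where dL: "\<forall>h\<in>J. finite (L h) \<and> L h \<subseteq> {i \<in> I. p i = h} \<and>
      (\<forall>i\<in>L h. d h i \<in> C i) \<and> f h = finsum G (d h) (L h)"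
    by metis
  define c where "c i = d (p i) i" for i
  have L: "finite (L h)" "L h \<subseteq> I" "\<And>i. i \<in> L h \<Longrightarrow> p i = h" "\<And>i. i \<in> L h \<Longrightarrow> c i \<in> C i"
    if "h \<in> J" for h
    using bspec[OF dL that] unfolding c_def by auto
  then have c_carr: "c i \<in> carrier G" if "h \<in> J" "i \<in> L h" for h i
    using that carr by blast
  have fL: "f h = finsum G c (L h)" if "h \<in> J" for h
  proof -
    have "f h = finsum G (d h) (L h)" using dL that by blast
    also have "\<dots> = finsum G c (L h)"
      using c_carr[OF that] L(3)[OF that] by (intro add.finprod_cong') (auto simp: c_def)
    finally show ?thesis .
  qed
  have "finsum G c (\<Union>(L ` J)) = finsum G (\<lambda>h. finsum G c (L h)) J"
    using J L(1) c_carr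
    by (intro add.finprod_UN_disjoint) (auto simp: pairwise_def disjnt_def dest: L(3))
  also have "\<dots> = finsum G f J"
    using fL c_carr by (intro add.finprod_cong') auto
  finally have "finsum G c (\<Union>(L ` J)) = \<zero>" using sum0 by simp
  moreover have "finite (\<Union>(L ` J))" "\<Union>(L ` J) \<subseteq> I" "\<forall>i\<in>\<Union>(L ` J). c i \<in> C i"
    using J L by auto
  ultimately have "\<forall>i\<in>\<Union>(L ` J). c i = \<zero>"
    using ind[unfolded independent_family_def, THEN spec[of _ "\<Union>(L ` J)"], THEN spec[of _ c]]
    by blast
  then have "finsum G c (L h) = finsum G (\<lambda>_. \<zero>) (L h)"
    using \<open>h \<in> J\<close> by (intro add.finprod_cong') auto
  then show "f h = \<zero>" using fL[OF \<open>h \<in> J\<close>] by simp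
qed

lemma independent_family_reindex:
  assumes ind: "independent_family G I C" and carr: "\<And>i. i \<in> I \<Longrightarrow> C i \<subseteq> carrier G"
    and inj: "inj_on \<phi> K" and sub: "\<phi> ` K \<subseteq> I"
  shows "independent_family G K (\<lambda>k. C (\<phi> k))"
  unfolding independent_family_def
proof (intro allI impI ballI; elim conjE)
  fix J f k
  assume J: "finite J" "J \<subseteq> K" and f: "\<forall>k\<in>J. f k \<in> C (\<phi> k)"
    and sum0: "finsum G f J = \<zero>" and "k \<in> J"
  let ?g = "\<lambda>i. f (inv_into K \<phi> i)"
  have g: "?g (\<phi> k) = f k" if "k \<in> J" for k using that J inj by (auto simp: subset_iff)
  have f_carr: "f k \<in> carrier G" if "k \<in> J" for k using that f carr sub J by blast
  have "finsum G ?g (\<phi> ` J) = finsum G (\<lambda>k. ?g (\<phi> k)) J"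
    using g f_carr J by (intro add.finprod_reindex inj_on_subset[OF inj]) auto
  also have "\<dots> = finsum G f J" using g f_carr by (intro add.finprod_cong') auto
  finally have "finsum G ?g (\<phi> ` J) = \<zero>" using sum0 by simp
  moreover have "finite (\<phi> ` J)" "\<phi> ` J \<subseteq> I" using J sub by auto
  moreover have "\<forall>i\<in>\<phi> ` J. ?g i \<in> C i" using f g by simp
  ultimately have "\<forall>i\<in>\<phi> ` J. ?g i = \<zero>"
    using ind[unfolded independent_family_def, THEN spec[of _ "\<phi> ` J"], THEN spec[of _ ?g]] by blast
  then show "f k = \<zero>" using g \<open>k \<in> J\<close> by auto
qed

text \<open>The carrier enters the definition of finite sums, so that sums in a subgroup have to be
  identified with sums in the whole group before a property of a family can be passed on.\<close>

lemma finsum_restrict_carrier: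
  assumes S: "subgroup S (add_monoid G)" and f: "\<And>i. i \<in> J \<Longrightarrow> f i \<in> S"
  shows "finsum (G\<lparr>carrier := S\<rparr>) f J = finsum G f J"
proof -
  interpret S: abelian_monoid "G\<lparr>carrier := S\<rparr>"
    using comm_monoid.submonoid_is_comm_monoid[OF add.comm_monoid_axioms
        subgroup.subgroup_is_submonoid[OF S]]
    by (simp add: abelian_monoid_def)
  show ?thesis
    using f
  proof (induction J rule: infinite_finite_induct)
    case (infinite J)
    then show ?case by (simp add: finsum_def finprod_def)
  next
    case empty
    show ?case using S.finsum_empty[of f] by simp
  next
    case (insert i J)
    then have "f \<in> J \<rightarrow> carrier G" "f i \<in> carrier G" using subgroup_addD(1)[OF S] by auto
    moreover have "f \<in> J \<rightarrow> carrier (G\<lparr>carrier := S\<rparr>)" "f i \<in> carrier (G\<lparr>carrier := S\<rparr>)"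
      using insert by auto
    ultimately show ?case
      using insert S.finsum_insert[of J i f] by simp
  qed
qed

lemma sum_of_family_restrict_carrier:
  assumes S: "subgroup S (add_monoid G)" and C: "\<And>i. i \<in> I \<Longrightarrow> C i \<subseteq> S"
  shows "sum_of_family (G\<lparr>carrier := S\<rparr>) I C = sum_of_family G I C"
proof -
  have "finsum (G\<lparr>carrier := S\<rparr>) f J = finsum G f J" if "J \<subseteq> I" "\<forall>i\<in>J. f i \<in> C i" for f J
    using that C by (intro finsum_restrict_carrier[OF S]) blast
  then show ?thesis unfolding sum_of_family_def by (intro Collect_cong) metis
qed

lemma independent_family_restrict_carrier:
  assumes S: "subgroup S (add_monoid G)" and C: "\<And>i. i \<in> I \<Longrightarrow> C i \<subseteq> S"
    and ind: "independent_family G I C"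
  shows "independent_family (G\<lparr>carrier := S\<rparr>) I C"
  unfolding independent_family_def
proof (intro allI impI; elim conjE)
  fix J f
  assume J: "finite J" "J \<subseteq> I" "\<forall>i\<in>J. f i \<in> C i"
    and "finsum (G\<lparr>carrier := S\<rparr>) f J = \<zero>\<^bsub>G\<lparr>carrier := S\<rparr>\<^esub>"
  moreover have "finsum (G\<lparr>carrier := S\<rparr>) f J = finsum G f J"
    using J C by (intro finsum_restrict_carrier[OF S]) blast
  ultimately have "finsum G f J = \<zero>" by simp
  with J show "\<forall>i\<in>J. f i = \<zero>\<^bsub>G\<lparr>carrier := S\<rparr>\<^esub>"
    using ind[unfolded independent_family_def, THEN spec[of _ J], THEN spec[of _ f]] by simp
qed

end

section \<open>Products of subspaces\<close>

lemma ideal_prod_least: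
  assumes "\<And>i j. \<lbrakk>i \<in> I; j \<in> J\<rbrakk> \<Longrightarrow> i \<otimes>\<^bsub>R\<^esub> j \<in> S"
    and "\<And>x y. \<lbrakk>x \<in> S; y \<in> S\<rbrakk> \<Longrightarrow> x \<oplus>\<^bsub>R\<^esub> y \<in> S"
  shows "ideal_prod R I J \<subseteq> S"
proof
  fix x assume "x \<in> ideal_prod R I J"
  then show "x \<in> S" by induction (use assms in auto)
qed

lemma ideal_prod_mono: "I \<subseteq> I' \<Longrightarrow> J \<subseteq> J' \<Longrightarrow> ideal_prod R I J \<subseteq> ideal_prod R I' J'"
  by (intro ideal_prod_least) (simp_all add: ideal_prod.prod ideal_prod.sum subsetD)

lemma ideal_prod_restrict_carrier: "ideal_prod (R\<lparr>carrier := S\<rparr>) I J = ideal_prod R I J"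
proof
  show "ideal_prod (R\<lparr>carrier := S\<rparr>) I J \<subseteq> ideal_prod R I J"
    by (rule ideal_prod_least) (simp_all add: ideal_prod.prod ideal_prod.sum)
  show "ideal_prod R I J \<subseteq> ideal_prod (R\<lparr>carrier := S\<rparr>) I J"
    using ideal_prod.intros[where R = "R\<lparr>carrier := S\<rparr>"] by (intro ideal_prod_least) simp_all
qed

section \<open>Homogeneous components\<close>

context graded_algebra
begin

lemma component_subgroup: "g \<in> carrier G \<Longrightarrow> subgroup (C g) (add_monoid A)"
  by (rule submodule.axioms(1)[OF component_subspace])

lemmas componentD = M.subgroup_addD[OF component_subgroup]

lemma component_carrier: "g \<in> carrier G \<Longrightarrow> x \<in> C g \<Longrightarrow> x \<in> carrier A"
  using componentD(1) by blast

lemma component_mult_mem: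
  "\<lbrakk>g \<in> carrier G; h \<in> carrier G; x \<in> C g; y \<in> C h\<rbrakk> \<Longrightarrow> x \<otimes>\<^bsub>A\<^esub> y \<in> C (g \<otimes>\<^bsub>G\<^esub> h)"
  by (rule subsetD[OF component_mult ideal_prod.prod])

lemma zero_in_component_product:
  assumes "g \<in> carrier G" "h \<in> carrier G"
  shows "\<zero>\<^bsub>A\<^esub> \<in> ideal_prod A (C g) (C h)"
  using ideal_prod.prod[OF componentD(2)[OF assms(1)] componentD(2)[OF assms(2)], of A] by simp

lemma sum_subgroup: "I \<subseteq> carrier G \<Longrightarrow> subgroup (sum_of_family A I C) (add_monoid A)"
  by (intro M.sum_of_family_subgroup component_subgroup) auto

lemmas sumD = M.subgroup_addD[OF sum_subgroup]

lemma component_in_sum: "\<lbrakk>I \<subseteq> carrier G; g \<in> I; x \<in> C g\<rbrakk> \<Longrightarrow> x \<in> sum_of_family A I C"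
  using componentD(1) by (intro M.sum_of_family_member) auto

lemma sum_induct [consumes 2, case_names zero add component]:
  assumes I: "I \<subseteq> carrier G" and x: "x \<in> sum_of_family A I C"
    and zero: "P \<zero>\<^bsub>A\<^esub>"
    and add: "\<And>x y. \<lbrakk>x \<in> carrier A; y \<in> carrier A; P x; P y\<rbrakk> \<Longrightarrow> P (x \<oplus>\<^bsub>A\<^esub> y)"
    and comp: "\<And>i x. \<lbrakk>i \<in> I; i \<in> carrier G; x \<in> C i; x \<in> carrier A\<rbrakk> \<Longrightarrow> P x"
  shows "P x"
  using x
proof (induction rule: M.sum_of_family_induct)
  case (carrier i)
  then show ?case using I componentD(1) by blast
next
  case (component i x)
  then show ?case using I component_carrier by (intro comp) auto
qed (fact zero add)+

lemma sum_submodule: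
  assumes I: "I \<subseteq> carrier G"
  shows "submodule (sum_of_family A I C) F A"
proof (rule submodule.intro[OF sum_subgroup[OF I]], unfold_locales)
  fix a x assume a: "a \<in> carrier F" and x: "x \<in> sum_of_family A I C"
  from I x show "a \<odot>\<^bsub>A\<^esub> x \<in> sum_of_family A I C"
  proof (induction rule: sum_induct)
    case (component i x)
    then show ?case using a submodule.smult_closed[OF component_subspace]
      by (intro component_in_sum[OF I])
  qed (use a sumD(2,3)[OF I] in \<open>simp_all add: smult_r_distr\<close>)
qed

lemma sum_mult_mem:
  assumes I: "I \<subseteq> carrier G" and J: "J \<subseteq> carrier G" and L: "L \<subseteq> carrier G"
    and IJ: "\<And>i j. \<lbrakk>i \<in> I; j \<in> J\<rbrakk> \<Longrightarrow> i \<otimes>\<^bsub>G\<^esub> j \<in> L"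
    and x: "x \<in> sum_of_family A I C" and y: "y \<in> sum_of_family A J C"
  shows "x \<otimes>\<^bsub>A\<^esub> y \<in> sum_of_family A L C"
  using I x
proof (induction rule: sum_induct)
  case (component i x)
  note x = component
  from J y show ?case
  proof (induction rule: sum_induct)
    case (component j y)
    then show ?case using component_mult_mem[of i j x y] IJ x
      by (intro component_in_sum[OF L]) auto
  qed (use x sumD(2,3)[OF L] in \<open>simp_all add: A.r_distr\<close>)
qed (use subsetD[OF sumD(1)[OF J] y] sumD(2,3)[OF L] in \<open>simp_all add: A.l_distr\<close>)

text \<open>Comparing coefficients in a fixed degree \<open>g\<close> needs only the decomposition of \<open>A\<close> into two
  summands, the component of degree \<open>g\<close> and the sum of all the others.\<close>

lemma decompose:
  assumes g: "g \<in> carrier G" and x: "x \<in> carrier A"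
  obtains c n where "c \<in> C g" "n \<in> sum_of_family A (carrier G - {g}) C" "x = c \<oplus>\<^bsub>A\<^esub> n"
proof -
  let ?N = "sum_of_family A (carrier G - {g}) C"
  have N: "carrier G - {g} \<subseteq> carrier G" by blast
  have "\<exists>c n. c \<in> C g \<and> n \<in> ?N \<and> x = c \<oplus>\<^bsub>A\<^esub> n"
    using subset_refl x[unfolded components_span]
  proof (induction rule: sum_induct)
    case zero
    then show ?case using componentD(2)[OF g] sumD(2)[OF N] by force
  next
    case (add x y)
    then obtain c n d m where *: "c \<in> C g" "n \<in> ?N" "x = c \<oplus>\<^bsub>A\<^esub> n"
      "d \<in> C g" "m \<in> ?N" "y = d \<oplus>\<^bsub>A\<^esub> m" by blast
    moreover from * have "c \<in> carrier A" "d \<in> carrier A" "n \<in> carrier A" "m \<in> carrier A"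
      using componentD(1)[OF g] sumD(1)[OF N] by auto
    ultimately have "x \<oplus>\<^bsub>A\<^esub> y = (c \<oplus>\<^bsub>A\<^esub> d) \<oplus>\<^bsub>A\<^esub> (n \<oplus>\<^bsub>A\<^esub> m)" by (simp add: M.add.m_ac)
    then show ?case using * componentD(3)[OF g] sumD(3)[OF N] by blast
  next
    case (component h x)
    show ?case
    proof (cases "h = g")
      case True
      have "x = x \<oplus>\<^bsub>A\<^esub> \<zero>\<^bsub>A\<^esub>" using component by simp
      then show ?thesis using True component sumD(2)[OF N] by blast
    next
      case False
      then have "x \<in> ?N" using component by (intro component_in_sum) auto
      moreover have "x = \<zero>\<^bsub>A\<^esub> \<oplus>\<^bsub>A\<^esub> x" using component by simp
      ultimately show ?thesis using componentD(2)[OF g] by blast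
    qed
  qed
  then show ?thesis using that by blast
qed

lemma component_disjoint_others:
  assumes g: "g \<in> carrier G" and x: "x \<in> C g" and "x \<in> sum_of_family A (carrier G - {g}) C"
  shows "x = \<zero>\<^bsub>A\<^esub>"
proof -
  obtain f J where J: "finite J" "J \<subseteq> carrier G - {g}" "\<forall>i\<in>J. f i \<in> C i" "x = finsum A f J"
    using assms(3) unfolding sum_of_family_def by blast
  \<comment> \<open>Moving \<open>x\<close> to the other side of \<open>x = finsum A f J\<close> gives a vanishing sum of homogeneous elements.\<close>
  let ?f = "f(g := \<ominus>\<^bsub>A\<^esub> x)"
  have xA: "x \<in> carrier A" using g x component_carrier by blast
  have f: "f i \<in> carrier A" if "i \<in> J" for i using J(2,3) component_carrier that by blast
  have "finsum A ?f J = finsum A f J" using f J(2) by (intro M.add.finprod_cong') auto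
  then have "finsum A ?f (insert g J) = \<ominus>\<^bsub>A\<^esub> x \<oplus>\<^bsub>A\<^esub> x"
    using J f xA by (subst M.finsum_insert) auto
  then have "finsum A ?f (insert g J) = \<zero>\<^bsub>A\<^esub>" using xA by (simp add: M.l_neg)
  moreover have "\<forall>i\<in>insert g J. ?f i \<in> C i" using J(2,3) componentD(4)[OF g x] by auto
  ultimately have "?f g = \<zero>\<^bsub>A\<^esub>"
    using components_independent[unfolded independent_family_def, rule_format, of "insert g J" ?f g]
      J g by auto
  then show ?thesis using xA by simp
qed

lemma component_part_unique:
  assumes g: "g \<in> carrier G" and x: "x \<in> C g" and c: "c \<in> C g"
    and n: "n \<in> sum_of_family A (carrier G - {g}) C" and eq: "x = c \<oplus>\<^bsub>A\<^esub> n"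
  shows "n = \<zero>\<^bsub>A\<^esub>"
proof -
  have carr: "c \<in> carrier A" "n \<in> carrier A"
    using component_carrier[OF g c] sumD(1)[of "carrier G - {g}"] n by auto
  then have "n = \<ominus>\<^bsub>A\<^esub> c \<oplus>\<^bsub>A\<^esub> x" unfolding eq by (simp add: M.r_neg1)
  then have "n \<in> C g" using componentD(3,4)[OF g] x c by simp
  then show ?thesis using component_disjoint_others[OF g _ n] by blast
qed

text \<open>Write \<open>1 = c + n\<close> with \<open>c\<close> of degree \<open>1\<close> and \<open>n\<close> in the other degrees. For \<open>x\<close> of degree \<open>h\<close>,
  comparing the parts of \<open>x = c x + n x\<close> outside degree \<open>h\<close> gives \<open>n x = 0\<close>. So \<open>n\<close> annihilates
  \<open>A\<close>, in particular \<open>n = n 1 = 0\<close>.\<close>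

lemma one_in_component_one: "\<one>\<^bsub>A\<^esub> \<in> C \<one>\<^bsub>G\<^esub>"
proof -
  have N: "carrier G - {g} \<subseteq> carrier G" for g by blast
  obtain c n where c: "c \<in> C \<one>\<^bsub>G\<^esub>" and n: "n \<in> sum_of_family A (carrier G - {\<one>\<^bsub>G\<^esub>}) C"
    and eq: "\<one>\<^bsub>A\<^esub> = c \<oplus>\<^bsub>A\<^esub> n"
    using decompose[of "\<one>\<^bsub>G\<^esub>" "\<one>\<^bsub>A\<^esub>"] by auto
  have carr: "c \<in> carrier A" "n \<in> carrier A"
    using component_carrier[OF _ c] sumD(1)[OF N] n by auto
  have "n \<otimes>\<^bsub>A\<^esub> x = \<zero>\<^bsub>A\<^esub>" if "x \<in> carrier A" for x
    using subset_refl that[unfolded components_span]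
  proof (induction rule: sum_induct)
    case (component h x)
    have "n \<otimes>\<^bsub>A\<^esub> x \<in> sum_of_family A (carrier G - {h}) C"
      using component by (intro sum_mult_mem[OF N _ N _ n component_in_sum[of "{h}"]]) auto
    moreover have "c \<otimes>\<^bsub>A\<^esub> x \<in> C h" using component_mult_mem[of "\<one>\<^bsub>G\<^esub>" h] c component by simp
    moreover have "x = c \<otimes>\<^bsub>A\<^esub> x \<oplus>\<^bsub>A\<^esub> n \<otimes>\<^bsub>A\<^esub> x"
      using component carr eq by (metis A.l_distr A.l_one)
    ultimately show ?case using component_part_unique component by blast
  qed (use carr in \<open>simp_all add: A.r_distr\<close>)
  from this[of "\<one>\<^bsub>A\<^esub>"] have "n = \<zero>\<^bsub>A\<^esub>" using carr by simp
  with eq c carr show ?thesis by simp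
qed

section \<open>Strength and the unit\<close>

text \<open>Writing \<open>1\<close> as a sum of products \<open>p q\<close> with \<open>p\<close> of degree \<open>u\<^sup>-\<^sup>1\<close> and \<open>q\<close> of degree \<open>u\<close>,
  the product \<open>x y\<close> becomes the sum of the \<open>(x p) (q y)\<close>, where \<open>u\<close> has cancelled in both factors.\<close>

lemma insert_unit:
  assumes gr: "g \<in> carrier G" "u \<in> carrier G" "h \<in> carrier G"
    and one: "\<one>\<^bsub>A\<^esub> \<in> ideal_prod A (C (inv\<^bsub>G\<^esub> u)) (C u)"
    and x: "x \<in> C (g \<otimes>\<^bsub>G\<^esub> u)" and y: "y \<in> C (inv\<^bsub>G\<^esub> u \<otimes>\<^bsub>G\<^esub> h)"
  shows "x \<otimes>\<^bsub>A\<^esub> y \<in> ideal_prod A (C g) (C h)"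
proof -
  have xA: "x \<in> carrier A" and yA: "y \<in> carrier A"
    using gr x y component_carrier[of "g \<otimes>\<^bsub>G\<^esub> u"] component_carrier[of "inv\<^bsub>G\<^esub> u \<otimes>\<^bsub>G\<^esub> h"] by auto
  have "z \<in> carrier A \<and> x \<otimes>\<^bsub>A\<^esub> z \<otimes>\<^bsub>A\<^esub> y \<in> ideal_prod A (C g) (C h)"
    if "z \<in> ideal_prod A (C (inv\<^bsub>G\<^esub> u)) (C u)" for z
    using that
  proof induction
    case (prod p q)
    then have pq: "p \<in> carrier A" "q \<in> carrier A"
      using gr component_carrier[of "inv\<^bsub>G\<^esub> u"] component_carrier[of u] by auto
    have "x \<otimes>\<^bsub>A\<^esub> p \<in> C g"
      using component_mult_mem[of "g \<otimes>\<^bsub>G\<^esub> u" "inv\<^bsub>G\<^esub> u" x p] gr x prod by (simp add: G.m_assoc)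
    moreover have "q \<otimes>\<^bsub>A\<^esub> y \<in> C h"
      using component_mult_mem[of u "inv\<^bsub>G\<^esub> u \<otimes>\<^bsub>G\<^esub> h" q y] gr y prod
      by (simp flip: G.m_assoc)
    ultimately have "(x \<otimes>\<^bsub>A\<^esub> p) \<otimes>\<^bsub>A\<^esub> (q \<otimes>\<^bsub>A\<^esub> y) \<in> ideal_prod A (C g) (C h)"
      by (rule ideal_prod.prod)
    then show ?case using xA yA pq by (simp add: A.m_assoc)
  next
    case (sum s t)
    then show ?case using xA yA ideal_prod.sum[of _ A "C g" "C h"]
      by (simp add: A.r_distr A.l_distr)
  qed
  from this[OF one] show ?thesis using xA by simp
qed

lemma strongly_gradedI:
  assumes one: "\<And>g. g \<in> carrier G \<Longrightarrow> \<one>\<^bsub>A\<^esub> \<in> ideal_prod A (C g) (C (inv\<^bsub>G\<^esub> g))"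
  shows "strongly_graded_algebra F A G C"
proof (unfold_locales, rule equalityI)
  fix g h assume gr: "g \<in> carrier G" "h \<in> carrier G"
  then show "ideal_prod A (C g) (C h) \<subseteq> C (g \<otimes>\<^bsub>G\<^esub> h)" by (rule component_mult)
  show "C (g \<otimes>\<^bsub>G\<^esub> h) \<subseteq> ideal_prod A (C g) (C h)"
  proof
    fix y assume y: "y \<in> C (g \<otimes>\<^bsub>G\<^esub> h)"
    \<comment> \<open>The case of the previous lemma where \<open>u = g\<^sup>-\<^sup>1\<close> and the left factor is \<open>1\<close>, of degree \<open>g u\<close>.\<close>
    have "\<one>\<^bsub>A\<^esub> \<otimes>\<^bsub>A\<^esub> y \<in> ideal_prod A (C g) (C h)"
      using gr one[OF gr(1)] y one_in_component_one
      by (intro insert_unit[of g "inv\<^bsub>G\<^esub> g"]) auto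
    moreover have "y \<in> carrier A" using gr y component_carrier[of "g \<otimes>\<^bsub>G\<^esub> h"] by blast
    ultimately show "y \<in> ideal_prod A (C g) (C h)" by simp
  qed
qed

section \<open>The induced gradings\<close>

lemma quotient_graded:
  assumes "group H" and hom: "\<pi> \<in> hom G H"
  shows "graded_algebra F A H (quotient_grading A G \<pi> C)"
proof -
  interpret H: group H by fact
  interpret \<pi>: group_hom G H \<pi> using hom by unfold_locales
  let ?Q = "quotient_grading A G \<pi> C"
  have fibre: "{g \<in> carrier G. \<pi> g = h} \<subseteq> carrier G" for h by blast
  have Q: "?Q = (\<lambda>h. sum_of_family A {g \<in> carrier G. \<pi> g = h} C)"
    unfolding quotient_grading_def by blast
  have Qsub: "subgroup (?Q h) (add_monoid A)" for h unfolding Q using sum_subgroup[OF fibre] .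
  show ?thesis
    unfolding graded_algebra_def graded_algebra_axioms_def
  proof (intro conjI allI impI assoc_unital_algebra_axioms \<open>group H\<close>)
    show "submodule (?Q h) F A" for h unfolding Q using sum_submodule[OF fibre] .
    show "independent_family A (carrier H) ?Q" unfolding Q
      using M.independent_family_blocks[OF components_independent] componentD(1) by blast
    have "C g \<subseteq> sum_of_family A (carrier H) ?Q" if "g \<in> carrier G" for g
    proof
      fix x assume "x \<in> C g"
      then have "x \<in> ?Q (\<pi> g)" unfolding Q using that by (intro component_in_sum[OF fibre]) auto
      then show "x \<in> sum_of_family A (carrier H) ?Q"
        using that M.subgroup_addD(1)[OF Qsub] by (intro M.sum_of_family_member) auto
    qed
    then have "sum_of_family A (carrier G) C \<subseteq> sum_of_family A (carrier H) ?Q"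
      by (intro M.sum_of_family_least M.sum_of_family_subgroup Qsub)
    moreover have "sum_of_family A (carrier H) ?Q \<subseteq> carrier A"
      by (rule M.subgroup_addD(1)[OF M.sum_of_family_subgroup[OF Qsub]])
    ultimately show "carrier A = sum_of_family A (carrier H) ?Q" using components_span by blast
    show "ideal_prod A (?Q h) (?Q h') \<subseteq> ?Q (h \<otimes>\<^bsub>H\<^esub> h')" for h h'
    proof (rule ideal_prod_least)
      show "x \<otimes>\<^bsub>A\<^esub> y \<in> ?Q (h \<otimes>\<^bsub>H\<^esub> h')" if "x \<in> ?Q h" "y \<in> ?Q h'" for x y
        using that unfolding Q by (rule sum_mult_mem[OF fibre fibre fibre, rotated]) auto
    qed (use M.subgroup_addD(3)[OF Qsub] in auto)
  qed
qed

lemma restricted_graded: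
  assumes "group K" and hom: "\<phi> \<in> hom K G" and inj: "inj_on \<phi> (carrier K)"
  shows "graded_algebra F (restricted_algebra A K \<phi> C) K (restricted_grading \<phi> C)"
proof -
  interpret K: group K by fact
  interpret \<phi>: group_hom K G \<phi> using hom by unfold_locales
  define S where "S = sum_of_family A (carrier K) (\<lambda>k. C (\<phi> k))"
  have img: "\<phi> ` carrier K \<subseteq> carrier G" by auto
  have Ssub: "subgroup S (add_monoid A)"
    unfolding S_def by (intro M.sum_of_family_subgroup component_subgroup) auto
  have CS: "C (\<phi> k) \<subseteq> S" if "k \<in> carrier K" for k
    unfolding S_def using that componentD(1)[of "\<phi> k"]
    by (auto intro: M.sum_of_family_member[where C = "\<lambda>k. C (\<phi> k)"])
  \<comment> \<open>Seen as a sum of the components of degree in the image of \<open>\<phi>\<close>, \<open>S\<close> inherits closure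
    under scalars and products from the \<open>G\<close>-grading.\<close>
  have S: "S = sum_of_family A (\<phi> ` carrier K) C"
  proof
    show "S \<subseteq> sum_of_family A (\<phi> ` carrier K) C"
      unfolding S_def
      by (rule M.sum_of_family_least[OF sum_subgroup[OF img]]) (auto intro: component_in_sum[OF img])
    show "sum_of_family A (\<phi> ` carrier K) C \<subseteq> S"
      by (rule M.sum_of_family_least[OF Ssub]) (use CS in auto)
  qed
  have "\<one>\<^bsub>A\<^esub> \<in> S" using CS[of "\<one>\<^bsub>K\<^esub>"] one_in_component_one by auto
  moreover have mult: "x \<otimes>\<^bsub>A\<^esub> y \<in> S" if "x \<in> S" "y \<in> S" for x y
    using that unfolding S
    by (rule sum_mult_mem[OF img img img, rotated]) (auto simp flip: \<phi>.hom_mult)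
  ultimately have "subring S A" using M.subgroup_addD[OF Ssub] by (intro A.subringI) auto
  then have ring: "ring (A\<lparr>carrier := S\<rparr>)" by (rule A.subring_is_ring)
  have "submodule S F A" unfolding S by (rule sum_submodule[OF img])
  then have module: "module F (A\<lparr>carrier := S\<rparr>)"
    using module_axioms by (rule submodule.submodule_is_module)
  interpret S: module F "A\<lparr>carrier := S\<rparr>" by fact
  have SA: "S \<subseteq> carrier A" by (rule M.subgroup_addD(1)[OF Ssub])
  have alg: "assoc_unital_algebra F (A\<lparr>carrier := S\<rparr>)"
    unfolding assoc_unital_algebra_def assoc_unital_algebra_axioms_def
    using module ring field_axioms SA smult_mult_left smult_mult_right by (auto simp: subset_iff)
  have comp: "submodule (C (\<phi> k)) F (A\<lparr>carrier := S\<rparr>)" if k: "k \<in> carrier K" for k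
  proof (rule S.submoduleI)
    note D = componentD[of "\<phi> k"]
    have "x \<in> C (\<phi> k) \<Longrightarrow> \<ominus>\<^bsub>A\<lparr>carrier := S\<rparr>\<^esub> x = \<ominus>\<^bsub>A\<^esub> x" for x
    proof -
      assume "x \<in> C (\<phi> k)"
      then have "x \<in> S" using CS k by blast
      then show ?thesis
        using M.add.m_inv_consistent[OF Ssub] by (simp add: a_inv_def)
    qed
    then show "x \<in> C (\<phi> k) \<Longrightarrow> \<ominus>\<^bsub>A\<lparr>carrier := S\<rparr>\<^esub> x \<in> C (\<phi> k)" for x
      using D(4) k by simp
    show "a \<in> carrier F \<Longrightarrow> x \<in> C (\<phi> k) \<Longrightarrow> a \<odot>\<^bsub>A\<lparr>carrier := S\<rparr>\<^esub> x \<in> C (\<phi> k)" for a x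
      using submodule.smult_closed[OF component_subspace[of "\<phi> k"]] k by simp
  qed (use CS k componentD[of "\<phi> k"] in auto)
  have "graded_algebra F (A\<lparr>carrier := S\<rparr>) K (\<lambda>k. C (\<phi> k))"
    unfolding graded_algebra_def graded_algebra_axioms_def
  proof (intro conjI allI impI alg \<open>group K\<close> comp)
    show "carrier (A\<lparr>carrier := S\<rparr>) =
        sum_of_family (A\<lparr>carrier := S\<rparr>) (carrier K) (\<lambda>k. C (\<phi> k))"
      using M.sum_of_family_restrict_carrier[OF Ssub, of "carrier K" "\<lambda>k. C (\<phi> k)"] CS
      by (simp add: S_def)
    show "independent_family (A\<lparr>carrier := S\<rparr>) (carrier K) (\<lambda>k. C (\<phi> k))"
      using componentD(1)
      by (intro M.independent_family_restrict_carrier[OF Ssub CS]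
          M.independent_family_reindex[OF components_independent _ inj img]) auto
  qed (use component_mult in \<open>simp_all add: ideal_prod_restrict_carrier\<close>)
  then show ?thesis unfolding restricted_algebra_def restricted_grading_def S_def .
qed

section \<open>Transfer of strength along a short exact sequence\<close>

lemma strong_imp_strong_quotient:
  assumes strong: "strongly_graded_algebra F A G C" and "group H" and epi: "\<pi> \<in> epi G H"
  shows "strongly_graded_algebra F A H (quotient_grading A G \<pi> C)"
proof -
  interpret H: group H by fact
  interpret \<pi>: group_hom G H \<pi> using epi by unfold_locales (simp add: epi_def)
  interpret Q: graded_algebra F A H "quotient_grading A G \<pi> C"
    by (rule quotient_graded) (use \<open>group H\<close> \<pi>.homh in auto)
  let ?Q = "quotient_grading A G \<pi> C"
  have CQ: "C g \<subseteq> ?Q (\<pi> g)" if "g \<in> carrier G" for g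
    unfolding quotient_grading_def using that by (auto intro: component_in_sum)
  show ?thesis
  proof (unfold_locales, rule equalityI[OF Q.component_mult])
    fix h h' assume h: "h \<in> carrier H" "h' \<in> carrier H"
    show "?Q (h \<otimes>\<^bsub>H\<^esub> h') \<subseteq> ideal_prod A (?Q h) (?Q h')"
    proof
      fix x assume x: "x \<in> ?Q (h \<otimes>\<^bsub>H\<^esub> h')"
      have "{g \<in> carrier G. \<pi> g = h \<otimes>\<^bsub>H\<^esub> h'} \<subseteq> carrier G" by blast
      then show "x \<in> ideal_prod A (?Q h) (?Q h')"
        using x[unfolded quotient_grading_def]
      proof (induction rule: sum_induct)
        case (component g x)
        have "h \<in> \<pi> ` carrier G" using epi h by (simp add: epi_def)
        then obtain a where a: "a \<in> carrier G" "\<pi> a = h" by blast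
        define b where "b = inv\<^bsub>G\<^esub> a \<otimes>\<^bsub>G\<^esub> g"
        have b: "b \<in> carrier G" "\<pi> b = h'" "g = a \<otimes>\<^bsub>G\<^esub> b"
          using a h component by (auto simp: b_def simp flip: G.m_assoc H.m_assoc)
        then have "x \<in> ideal_prod A (C a) (C b)"
          using strongly_graded_algebra.component_mult_eq[OF strong a(1) b(1)] component by simp
        then show ?case using ideal_prod_mono[OF CQ[OF a(1)] CQ[OF b(1)]] a b by auto
      qed (use h Q.zero_in_component_product in \<open>simp_all add: ideal_prod.sum\<close>)
    qed
  qed
qed

lemma strong_imp_strong_restricted:
  assumes strong: "strongly_graded_algebra F A G C" and "group K" and mon: "\<phi> \<in> mon K G"
  shows "strongly_graded_algebra F (restricted_algebra A K \<phi> C) K (restricted_grading \<phi> C)"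
proof (intro strongly_graded_algebra.intro strongly_graded_algebra_axioms.intro)
  have hom: "\<phi> \<in> hom K G" and "inj_on \<phi> (carrier K)" using mon by (auto simp: mon_def)
  then show "graded_algebra F (restricted_algebra A K \<phi> C) K (restricted_grading \<phi> C)"
    using \<open>group K\<close> by (intro restricted_graded)
  show "ideal_prod (restricted_algebra A K \<phi> C) (restricted_grading \<phi> C k) (restricted_grading \<phi> C l)
      = restricted_grading \<phi> C (k \<otimes>\<^bsub>K\<^esub> l)" if "k \<in> carrier K" "l \<in> carrier K" for k l
    using that hom_in_carrier[OF hom] hom_mult[OF hom]
      strongly_graded_algebra.component_mult_eq[OF strong]
    by (simp add: restricted_algebra_def restricted_grading_def ideal_prod_restrict_carrier)
qed

lemma strong_quotient_restricted_imp_strong: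
  assumes strongQ: "strongly_graded_algebra F A H (quotient_grading A G \<pi> C)"
    and strongK: "strongly_graded_algebra F (restricted_algebra A K \<phi> C) K (restricted_grading \<phi> C)"
    and hom\<pi>: "\<pi> \<in> hom G H" and hom\<phi>: "\<phi> \<in> hom K G"
    and exact: "kernel G H \<pi> \<subseteq> \<phi> ` carrier K"
  shows "strongly_graded_algebra F A G C"
proof (rule strongly_gradedI)
  interpret Q: strongly_graded_algebra F A H "quotient_grading A G \<pi> C" by fact
  interpret R: strongly_graded_algebra F "restricted_algebra A K \<phi> C" K "restricted_grading \<phi> C"
    by fact
  interpret \<pi>: group_hom G H \<pi> using hom\<pi> by unfold_locales
  interpret \<phi>: group_hom K G \<phi> using hom\<phi> by unfold_locales
  let ?Q = "quotient_grading A G \<pi> C"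
  fix g assume g: "g \<in> carrier G"
  define D where "D = ideal_prod A (C g) (C (inv\<^bsub>G\<^esub> g))"
  define N where "N = sum_of_family A (carrier G - {\<one>\<^bsub>G\<^esub>}) C"
  have D_one: "D \<subseteq> C \<one>\<^bsub>G\<^esub>" using component_mult[of g "inv\<^bsub>G\<^esub> g"] g by (simp add: D_def)
  have D_zero: "\<zero>\<^bsub>A\<^esub> \<in> D" unfolding D_def using g by (intro zero_in_component_product) auto
  have D_carr: "D \<subseteq> carrier A" using D_one component_carrier by blast
  have N_sub: "subgroup N (add_monoid A)" unfolding N_def by (intro sum_subgroup) blast
  note ND = M.subgroup_addD[OF N_sub]
  \<comment> \<open>The elements whose part of degree \<open>1\<close> lies in \<open>D\<close>; the aim is to show that \<open>1\<close> is one of them.\<close>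
  define T where "T = {d \<oplus>\<^bsub>A\<^esub> n | d n. d \<in> D \<and> n \<in> N}"
  have T_add: "x \<oplus>\<^bsub>A\<^esub> y \<in> T" if xy: "x \<in> T" "y \<in> T" for x y
  proof -
    obtain d n d' n' where *: "d \<in> D" "n \<in> N" "d' \<in> D" "n' \<in> N"
      "x = d \<oplus>\<^bsub>A\<^esub> n" "y = d' \<oplus>\<^bsub>A\<^esub> n'" using xy unfolding T_def by blast
    then have "d \<in> carrier A" "n \<in> carrier A" "d' \<in> carrier A" "n' \<in> carrier A"
      using D_carr ND(1) by auto
    then have "x \<oplus>\<^bsub>A\<^esub> y = (d \<oplus>\<^bsub>A\<^esub> d') \<oplus>\<^bsub>A\<^esub> (n \<oplus>\<^bsub>A\<^esub> n')" using * by (simp add: M.add.m_ac)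
    moreover have "d \<oplus>\<^bsub>A\<^esub> d' \<in> D" using * unfolding D_def by (blast intro: ideal_prod.sum)
    ultimately show ?thesis using * ND(3) unfolding T_def by blast
  qed
  have DT: "x \<in> T" if "x \<in> D" for x
  proof -
    have "x = x \<oplus>\<^bsub>A\<^esub> \<zero>\<^bsub>A\<^esub>" using that D_carr by (auto simp: subset_iff)
    then show ?thesis using that ND(2) unfolding T_def by blast
  qed
  have NT: "x \<in> T" if "x \<in> N" for x
  proof -
    have "x = \<zero>\<^bsub>A\<^esub> \<oplus>\<^bsub>A\<^esub> x" using that ND(1) by (auto simp: subset_iff)
    then show ?thesis using that D_zero unfolding T_def by blast
  qed
  have unitK: "\<one>\<^bsub>A\<^esub> \<in> ideal_prod A (C (inv\<^bsub>G\<^esub> (\<phi> k))) (C (\<phi> k))" if "k \<in> carrier K" for k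
    using R.component_mult_eq[of "inv\<^bsub>K\<^esub> k" k] that one_in_component_one
    by (simp add: restricted_algebra_def restricted_grading_def ideal_prod_restrict_carrier)
  have homogeneous: "x \<otimes>\<^bsub>A\<^esub> y \<in> T"
    if p: "p \<in> carrier G" "\<pi> p = \<pi> g" and q: "q \<in> carrier G" and x: "x \<in> C p" and y: "y \<in> C q"
    for p q x y
  proof (cases "p \<otimes>\<^bsub>G\<^esub> q = \<one>\<^bsub>G\<^esub>")
    case True
    \<comment> \<open>\<open>p\<close> and \<open>g\<close> differ by an element of the image of \<open>K\<close>, where a unit can be inserted.\<close>
    have "inv\<^bsub>G\<^esub> g \<otimes>\<^bsub>G\<^esub> p \<in> kernel G H \<pi>" using g p by (simp add: kernel_def)
    then obtain k where k: "k \<in> carrier K" "inv\<^bsub>G\<^esub> g \<otimes>\<^bsub>G\<^esub> p = \<phi> k" using exact by blast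
    then have p_eq: "p = g \<otimes>\<^bsub>G\<^esub> \<phi> k" using g p by (metis G.inv_solve_left G.inv_closed \<phi>.hom_closed)
    have "q = inv\<^bsub>G\<^esub> p" using True p q by (metis G.inv_equality G.inv_comm)
    then have q_eq: "q = inv\<^bsub>G\<^esub> (\<phi> k) \<otimes>\<^bsub>G\<^esub> inv\<^bsub>G\<^esub> g" using p_eq g k by (simp add: G.inv_mult_group)
    have "x \<otimes>\<^bsub>A\<^esub> y \<in> D" unfolding D_def
      by (rule insert_unit[of g "\<phi> k"]) (use g k unitK x y p_eq q_eq in auto)
    then show ?thesis by (rule DT)
  next
    case False
    then have "x \<otimes>\<^bsub>A\<^esub> y \<in> N" unfolding N_def
      using component_mult_mem[of p q x y] p q x y
      by (intro component_in_sum[of _ "p \<otimes>\<^bsub>G\<^esub> q"]) auto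
    then show ?thesis by (rule NT)
  qed
  have prod: "x \<otimes>\<^bsub>A\<^esub> y \<in> T" if x: "x \<in> ?Q (\<pi> g)" and y: "y \<in> ?Q (\<pi> (inv\<^bsub>G\<^esub> g))" for x y
  proof -
    have yA: "y \<in> carrier A" using y Q.component_carrier[of "\<pi> (inv\<^bsub>G\<^esub> g)"] g by simp
    have zero: "\<zero>\<^bsub>A\<^esub> \<in> T" using DT D_zero .
    have fibre: "{p \<in> carrier G. \<pi> p = h} \<subseteq> carrier G" for h by blast
    show ?thesis
      using fibre x[unfolded quotient_grading_def]
    proof (induction rule: sum_induct)
      case (component p x)
      note x = component
      show ?case
        using fibre y[unfolded quotient_grading_def]
      proof (induction rule: sum_induct)
        case (component q y)
        then show ?case using x by (intro homogeneous[of p q]) auto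
      qed (use x zero T_add in \<open>simp_all add: A.r_distr\<close>)
    qed (use yA zero T_add in \<open>simp_all add: A.l_distr\<close>)
  qed
  have "\<one>\<^bsub>A\<^esub> \<in> ?Q \<one>\<^bsub>H\<^esub>" by (rule Q.one_in_component_one)
  also have "?Q \<one>\<^bsub>H\<^esub> = ideal_prod A (?Q (\<pi> g)) (?Q (\<pi> (inv\<^bsub>G\<^esub> g)))"
    using Q.component_mult_eq[of "\<pi> g" "\<pi> (inv\<^bsub>G\<^esub> g)"] g by simp
  also have "\<dots> \<subseteq> T" using prod T_add by (rule ideal_prod_least)
  finally obtain d n where dn: "d \<in> D" "n \<in> N" "\<one>\<^bsub>A\<^esub> = d \<oplus>\<^bsub>A\<^esub> n" unfolding T_def by blast
  have "n = \<zero>\<^bsub>A\<^esub>"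
    using component_part_unique[OF _ one_in_component_one _ dn(2)[unfolded N_def] dn(3)] dn(1) D_one
    by blast
  with dn D_carr have "\<one>\<^bsub>A\<^esub> = d" by auto
  then show "\<one>\<^bsub>A\<^esub> \<in> ideal_prod A (C g) (C (inv\<^bsub>G\<^esub> g))" using dn(1) D_def by simp
qed

end

theorem lemmaA1:
  fixes F :: "('f, 'r) ring_scheme"
    and A :: "('f, 'a, 'm) module_scheme"
    and K :: "('k, 'x) monoid_scheme"
    and G :: "('g, 'y) monoid_scheme"
    and H :: "('h, 'z) monoid_scheme"
    and \<phi> :: "'k \<Rightarrow> 'g"
    and \<pi> :: "'g \<Rightarrow> 'h"
    and C :: "'g \<Rightarrow> 'a set"
  assumes "field F"
    and char_zero: "\<And>n::nat. n > 0 \<Longrightarrow> add_pow F n \<one>\<^bsub>F\<^esub> \<noteq> \<zero>\<^bsub>F\<^esub>"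
    and "short_exact_abelian K \<phi> G \<pi> H"
    and "graded_algebra F A G C"
  shows "strongly_graded_algebra F A G C \<longleftrightarrow>
      strongly_graded_algebra F A H (quotient_grading A G \<pi> C) \<and>
      strongly_graded_algebra F (restricted_algebra A K \<phi> C) K (restricted_grading \<phi> C)"
proof -
  interpret graded_algebra F A G C by fact
  have seq: "group K" "group H" "\<phi> \<in> mon K G" "\<pi> \<in> epi G H" "kernel G H \<pi> = \<phi> ` carrier K"
    using assms(3) unfolding short_exact_abelian_def by (auto intro: comm_group.axioms)
  then have hom: "\<pi> \<in> hom G H" "\<phi> \<in> hom K G" by (auto simp: mon_def epi_def)
  show ?thesis
  proof (intro iffI conjI; (elim conjE)?)
    assume strong: "strongly_graded_algebra F A G C"
    show "strongly_graded_algebra F A H (quotient_grading A G \<pi> C)"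
      using strong seq(2,4) by (rule strong_imp_strong_quotient)
    show "strongly_graded_algebra F (restricted_algebra A K \<phi> C) K (restricted_grading \<phi> C)"
      using strong seq(1,3) by (rule strong_imp_strong_restricted)
  next
    assume "strongly_graded_algebra F A H (quotient_grading A G \<pi> C)"
      and "strongly_graded_algebra F (restricted_algebra A K \<phi> C) K (restricted_grading \<phi> C)"
    then show "strongly_graded_algebra F A G C"
      using hom by (rule strong_quotient_restricted_imp_strong) (simp add: seq(5))
  qed
qed

end
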